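(* Let $X=\mathbb{T}^2$ and let $G$ be the subgroup of $X$ generated by all elements of $X$ of order $2$. Then there exist a topological automorphism $\alpha$ of the group $X$ satisfying the condition $\mathrm{Ker}(I+\alpha)=\{0\}$ and independent random variables $\xi_1$ and $\xi_2$ with values in $X$ and distributions $\mu_1$ and $\mu_2$ with nonvanishing characteristic functions such that the conditional distribution of the linear form $L_2=\xi_1+\alpha\xi_2$ given $L_1=\xi_1+\xi_2$ is symmetric, whereas $\mu_j\notin\Gamma(X)*\mathrm{M}^1(G)$, $j=1,2$ (that is, neither $\mu_1$ nor $\mu_2$ is a convolution of a Gaussian distribution on $X$ and a distribution concentrated on $G$).
   Context: $\mathbb{T}$ is the circle group (complex numbers of absolute value $1$ under multiplication), and $\mathbb{T}^2$ is the $2$-dimensional torus; its group operation is written additively in expressions such as $\xi_1+\alpha\xi_2$. $I$ is the identity automorphism; a topological automorphism is a group automorphism that is a homeomorphism. $Y=X^*$ denotes the (Pontryagin) character group of $X$, and $(x,y)$ the value of a character $y\in Y$ at $x\in X$. $\mathrm{M}^1(X)$ is the convolution semigroup of Borel probability measures (distributions) on $X$. For $\mu\in\mathrm{M}^1(X)$ its characteristic function is $\hat\mu(y)=\int_X (x,y)\,d\mu(x)$, $y\in Y$; it is nonvanishing if $\hat\mu(y)\neq 0$ for all $y\in Y$. For a Borel subgroup $F$ of $X$, $\mathrm{M}^1(F)$ is the set of distributions in $\mathrm{M}^1(X)$ concentrated on $F$. A distribution $\gamma\in\mathrm{M}^1(X)$ is called Gaussian if $\hat\gamma(y)=(x,y)\exp\{-\varphi(y)\}$,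 $y\in Y$, for some $x\in X$ and some continuous nonnegative function $\varphi$ on $Y$ satisfying $\varphi(u+v)+\varphi(u-v)=2[\varphi(u)+\varphi(v)]$ for all $u,v\in Y$ (so degenerate distributions are Gaussian). $\Gamma(X)$ is the set of Gaussian distributions on $X$, and $\Gamma(X)*\mathrm{M}^1(G)=\{\gamma*\omega:\gamma\in\Gamma(X),\ \omega\in\mathrm{M}^1(G)\}$. The conditional distribution of $L_2$ given $L_1$ is symmetric if the random vectors $(L_1,L_2)$ and $(L_1,-L_2)$ with values in $X\times X$ are identically distributed. *)

theory Defs
  imports
    "HOL-Probability.Probability"
    "HOL-Computational_Algebra.Group_Closure"
begin

(* The circle group T: multiplication of unit complex numbers, written additively so that the
   type-class hierarchy for topological abelian groups applies. The topology is the one inherited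
   from the complex plane. *)
typedef circle = "{z :: complex. cmod z = 1}"
  morphisms circle_val Abs_circle
  by (rule exI[of _ 1]) simp

lemma norm_circle_val [simp]: "cmod (circle_val x) = 1"
  using circle_val[of x] by simp

instantiation circle :: ab_group_add
begin

definition zero_circle :: circle where "0 = Abs_circle 1"
definition plus_circle :: "circle \<Rightarrow> circle \<Rightarrow> circle"
  where "x + y = Abs_circle (circle_val x * circle_val y)"
definition uminus_circle :: "circle \<Rightarrow> circle"
  where "- x = Abs_circle (inverse (circle_val x))"
definition minus_circle :: "circle \<Rightarrow> circle \<Rightarrow> circle"
  where "x - y = Abs_circle (circle_val x / circle_val y)"

lemma circle_val_zero [simp]: "circle_val 0 = 1"
  by (simp add: zero_circle_def Abs_circle_inverse)

lemma circle_val_plus [simp]: "circle_val (x + y) = circle_val x * circle_val y"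
  by (simp add: plus_circle_def Abs_circle_inverse norm_mult)

lemma circle_val_uminus [simp]: "circle_val (- x) = inverse (circle_val x)"
  by (simp add: uminus_circle_def Abs_circle_inverse norm_inverse)

lemma circle_val_minus [simp]: "circle_val (x - y) = circle_val x / circle_val y"
  by (simp add: minus_circle_def Abs_circle_inverse norm_divide)

lemma circle_val_neq_0 [simp]: "circle_val x \<noteq> 0"
  by (metis norm_circle_val norm_zero zero_neq_one)

instance
  by standard (simp_all add: circle_val_inject[symmetric] field_simps)

end

instantiation circle :: metric_space
begin

definition dist_circle :: "circle \<Rightarrow> circle \<Rightarrow> real"
  where "dist x y = dist (circle_val x) (circle_val y)"
definition uniformity_circle_def:
  "(uniformity :: (circle \<times> circle) filter) = (INF e\<in>{0 <..}. principal {(x, y). dist x y < e})"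
definition open_circle_def:
  "open (U :: circle set) \<longleftrightarrow> (\<forall>x\<in>U. eventually (\<lambda>(x', y). x' = x \<longrightarrow> y \<in> U) uniformity)"

instance
  by standard
    (simp_all add: dist_circle_def uniformity_circle_def open_circle_def circle_val_inject
      dist_triangle2)

end

lemma tendsto_circle_iff:
  "(f \<longlongrightarrow> l) F \<longleftrightarrow> ((\<lambda>x. circle_val (f x)) \<longlongrightarrow> circle_val l) F"
  by (simp add: tendsto_iff dist_circle_def)

lemma continuous_on_circle_val [continuous_intros]:
  "continuous_on S f \<Longrightarrow> continuous_on S (\<lambda>x. circle_val (f x))"
  by (simp add: continuous_on_def tendsto_circle_iff)

instance circle :: topological_ab_group_add
proof
  fix a b :: circle
  show "((\<lambda>x. fst x + snd x) \<longlongrightarrow> a + b) (nhds a \<times>\<^sub>F nhds b)"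
  proof -
    have "((\<lambda>x. circle_val (fst x)) \<longlongrightarrow> circle_val a) (nhds a \<times>\<^sub>F nhds b)"
         "((\<lambda>x. circle_val (snd x)) \<longlongrightarrow> circle_val b) (nhds a \<times>\<^sub>F nhds b)"
      using tendsto_circle_iff filterlim_fst filterlim_snd by blast+
    then show ?thesis
      by (simp add: tendsto_circle_iff tendsto_mult)
  qed
  have "(circle_val \<longlongrightarrow> circle_val a) (nhds a)"
    using tendsto_circle_iff[of "\<lambda>x. x" a "nhds a"] by (simp add: filterlim_ident)
  then show "(uminus \<longlongrightarrow> - a) (nhds a)"
    by (simp add: tendsto_circle_iff tendsto_inverse)
qed

instance circle :: second_countable_topology
proof
  obtain \<B> :: "complex set set" where \<B>: "countable \<B>" "topological_basis \<B>"
    using ex_countable_basis by auto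
  have "topological_basis ((\<lambda>B. circle_val -` B) ` \<B>)"
  proof (rule topological_basisI)
    fix U assume "U \<in> (\<lambda>B. circle_val -` B) ` \<B>"
    then show "open U"
      using \<B> continuous_on_circle_val[of UNIV "\<lambda>x. x"]
      by (auto simp: continuous_on_id topological_basis_open intro!: open_vimage)
  next
    fix U :: "circle set" and x assume "open U" "x \<in> U"
    then obtain e where e: "e > 0" "\<And>y. dist y x < e \<Longrightarrow> y \<in> U"
      by (metis open_dist)
    obtain B where B: "B \<in> \<B>" "circle_val x \<in> B" "B \<subseteq> ball (circle_val x) e"
      using topological_basisE[OF \<B>(2) open_ball, of "circle_val x" "circle_val x" e] e(1)
      by auto
    have "circle_val -` B \<subseteq> U"
      using B(3) e(2) by (auto simp: dist_circle_def dist_commute subset_eq)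
    then show "\<exists>B'\<in>(\<lambda>B. circle_val -` B) ` \<B>. x \<in> B' \<and> B' \<subseteq> U"
      using B by blast
  qed
  then show "\<exists>B :: circle set set. countable B \<and> open = generate_topology B"
    using \<B>(1) topological_basis_imp_subbasis by blast
qed

instance prod :: (topological_monoid_add, topological_monoid_add) topological_monoid_add
proof
  fix a b :: "'a \<times> 'b"
  have fst: "((\<lambda>x. fst (fst x)) \<longlongrightarrow> fst a) (nhds a \<times>\<^sub>F nhds b)"
    and snd: "((\<lambda>x. snd (fst x)) \<longlongrightarrow> snd a) (nhds a \<times>\<^sub>F nhds b)"
    by (rule tendsto_fst tendsto_snd, rule filterlim_fst)+
  have fst': "((\<lambda>x. fst (snd x)) \<longlongrightarrow> fst b) (nhds a \<times>\<^sub>F nhds b)"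
    and snd': "((\<lambda>x. snd (snd x)) \<longlongrightarrow> snd b) (nhds a \<times>\<^sub>F nhds b)"
    by (rule tendsto_fst tendsto_snd, rule filterlim_snd)+
  show "((\<lambda>x. fst x + snd x) \<longlongrightarrow> a + b) (nhds a \<times>\<^sub>F nhds b)"
    unfolding plus_prod_def by (intro tendsto_Pair tendsto_add fst snd fst' snd')
qed

instance prod :: (topological_group_add, topological_group_add) topological_group_add
proof
  fix a :: "'a \<times> 'b"
  show "(uminus \<longlongrightarrow> - a) (nhds a)"
    unfolding uminus_prod_def
    by (intro tendsto_Pair tendsto_minus tendsto_fst tendsto_snd filterlim_ident)
qed

instance prod :: (topological_ab_group_add, topological_ab_group_add) topological_ab_group_add ..

type_synonym torus2 = "circle \<times> circle"

definition topological_automorphism :: "('a::topological_ab_group_add \<Rightarrow> 'a) \<Rightarrow> bool"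
  where "topological_automorphism \<alpha> \<longleftrightarrow>
    (\<forall>x y. \<alpha> (x + y) = \<alpha> x + \<alpha> y) \<and> bij \<alpha> \<and>
    continuous_on UNIV \<alpha> \<and> continuous_on UNIV (inv \<alpha>)"

(* n is the least positive integer with n x = 0; the n-fold sum n x is an iterated addition. *)
definition has_order :: "'a::ab_group_add \<Rightarrow> nat \<Rightarrow> bool"
  where "has_order x n \<longleftrightarrow>
    n > 0 \<and> ((+) x ^^ n) 0 = 0 \<and> (\<forall>m. 0 < m \<and> m < n \<longrightarrow> ((+) x ^^ m) 0 \<noteq> 0)"

(* The group operation on characters is the pointwise one and is written out where it is used. *)
definition characters :: "('a::topological_ab_group_add \<Rightarrow> circle) set"
  where "characters =
    {y. continuous_on UNIV y \<and> (\<forall>x x'. y (x + x') = y x + y x')}"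

text \<open>The compact-open topology on the character group.\<close>
definition character_topology :: "('a::topological_ab_group_add \<Rightarrow> circle) topology"
  where "character_topology =
    topology_generated_by {{y \<in> characters. y ` K \<subseteq> U} | K U. compact K \<and> open U}"

definition distributions :: "'a::topological_space measure set"
  where "distributions = {\<mu>. prob_space \<mu> \<and> sets \<mu> = sets borel}"

(* Only meaningful for Borel sets F, since measure assigns 0 to other sets. *)
definition distributions_on :: "'a::topological_space set \<Rightarrow> 'a measure set"
  where "distributions_on F = {\<mu> \<in> distributions. measure \<mu> F = 1}"

definition characteristic_function ::
    "'a::topological_ab_group_add measure \<Rightarrow> ('a \<Rightarrow> circle) \<Rightarrow> complex"
  where "characteristic_function \<mu> y = (LINT x|\<mu>. circle_val (y x))"

definition nonvanishing_cf :: "'a::topological_ab_group_add measure \<Rightarrow> bool"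
  where "nonvanishing_cf \<mu> \<longleftrightarrow> (\<forall>y\<in>characters. characteristic_function \<mu> y \<noteq> 0)"

definition gaussian_distributions :: "'a::topological_ab_group_add measure set"
  where "gaussian_distributions =
    {\<gamma> \<in> distributions. \<exists>x \<phi>.
       continuous_map character_topology euclideanreal \<phi> \<and>
       (\<forall>y\<in>characters. 0 \<le> \<phi> y) \<and>
       (\<forall>u\<in>characters. \<forall>v\<in>characters.
          \<phi> (\<lambda>t. u t + v t) + \<phi> (\<lambda>t. u t - v t) = 2 * (\<phi> u + \<phi> v)) \<and>
       (\<forall>y\<in>characters.
          characteristic_function \<gamma> y = circle_val (y x) * complex_of_real (exp (- \<phi> y)))}"

(* The library's convolution is restricted to Euclidean spaces. *)
definition group_convolution ::
    "'a::topological_ab_group_add measure \<Rightarrow> 'a measure \<Rightarrow> 'a measure"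
  where "group_convolution \<mu> \<nu> = distr (\<mu> \<Otimes>\<^sub>M \<nu>) borel (\<lambda>(x, y). x + y)"

definition gaussian_conv :: "'a::topological_ab_group_add set \<Rightarrow> 'a measure set"
  where "gaussian_conv G =
    {group_convolution \<gamma> \<omega> | \<gamma> \<omega>. \<gamma> \<in> gaussian_distributions \<and> \<omega> \<in> distributions_on G}"

text \<open>Symmetry of the conditional distribution of \<open>L2\<close> given \<open>L1\<close>, which by definition is
  equality of the joint distributions of \<open>(L1, L2)\<close> and \<open>(L1, - L2)\<close>.\<close>
definition conditionally_symmetric ::
    "'w measure \<Rightarrow> ('w \<Rightarrow> 'a::topological_ab_group_add) \<Rightarrow> ('w \<Rightarrow> 'a) \<Rightarrow> bool"
  where "conditionally_symmetric M L2 L1 \<longleftrightarrow>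
    distr M borel (\<lambda>w. (L1 w, L2 w)) = distr M borel (\<lambda>w. (L1 w, - L2 w))"

end

theory Submission
  imports Defs
begin

text \<open>
  Identify the character group of the torus with pairs of integers. If \<open>f\<close> and \<open>g\<close> are the
  characteristic functions of \<open>\<xi>\<^sub>1\<close> and \<open>\<xi>\<^sub>2\<close> and \<open>A\<close> is the integer matrix dual to \<open>\<alpha>\<close>, then the
  conditional symmetry says that
  \<open>f (u + v) g (u + A v) = f (u - v) g (u - A v)\<close> for all \<open>u\<close>, \<open>v\<close>.
  For \<open>f = exp (- c \<langle>P u, u\<rangle>)\<close> and \<open>g = exp (- c \<langle>Q u, u\<rangle>)\<close> this means \<open>P = - Q A\<close>. The choice
  \<open>A = ((-2, -1), (-1, -1))\<close> makes \<open>Q = 1\<close>, \<open>P = - A\<close> a pair of positive definite solutions, and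
  \<open>det (1 + A) = -1\<close> makes the kernel of \<open>I + \<alpha>\<close> trivial.

  Since \<open>u + v\<close> and \<open>u - v\<close> are congruent modulo 2, the equation survives if \<open>f\<close> and \<open>g\<close> are
  multiplied by any functions of \<open>u\<close> modulo 2. Such a factor is the characteristic function of a
  distribution on \<open>G\<close> only if it is positive definite, hence bounded by its value at zero. But a
  factor violating this bound may still leave the product positive definite: when the Gaussian
  factor decays fast, the Fourier series with the perturbed coefficients stays
  close to 1 and is therefore a probability density.

  Because \<open>\<langle>P u, u\<rangle> = u\<^sub>1\<^sup>2 + (u\<^sub>1 + u\<^sub>2)\<^sup>2\<close>, a single distribution \<open>\<rho>\<close> on the circle is enough. Let its
  characteristic function be \<open>r k = \<kappa> k / 5 ^ k\<^sup>2\<close> with \<open>\<kappa> = 1\<close> on even and \<open>\<kappa> = 2\<close> on odd integers.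
  Then \<open>g (m, n) = r m * r n\<close> belongs to the product of two copies of \<open>\<rho>\<close>, and
  \<open>f (m, n) = r m * r (m + n)\<close> to its image under a shear
  (\<open>circle_distribution_with_coefficients\<close>, \<open>skewed_theta_coefficient_mult4\<close>).

  Every element of \<open>\<Gamma> * M\<^sup>1(G)\<close> has a characteristic function with \<open>\<bar>f y\<bar> ^ 4 \<le> \<bar>f (2 y)\<bar>\<close>
  (\<open>gaussian_conv_norm_characteristic_function\<close>), while \<open>(r 1) ^ 4 = 16 / 625\<close> exceeds
  \<open>r 2 = 1 / 625\<close>.

  Passing from the functional equation to an equality of joint distributions uses that
  distributions on a compact group whose characters separate points are determined by their
  characteristic functions (\<open>distribution_eqI_characteristic_function\<close>). That all characters are
  given by integers is \<open>circle_characterE\<close> and \<open>torus_characterE\<close>.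
\<close>

section \<open>Characters of the circle and of the torus\<close>

definition circle_of_real :: "real \<Rightarrow> circle"
  where "circle_of_real t = Abs_circle (cis (2 * pi * t))"

lemma circle_val_circle_of_real [simp]: "circle_val (circle_of_real t) = cis (2 * pi * t)"
  by (simp add: circle_of_real_def Abs_circle_inverse)

lemma circle_of_real_add: "circle_of_real (s + t) = circle_of_real s + circle_of_real t"
  by (simp add: circle_val_inject[symmetric] cis_mult algebra_simps)

lemma continuous_on_circleI:
  "continuous_on S (\<lambda>x. circle_val (f x)) \<Longrightarrow> continuous_on S f"
  by (simp add: continuous_on_def tendsto_circle_iff)

lemma continuous_on_circle_of_real [continuous_intros]: "continuous_on S circle_of_real"
  by (rule continuous_on_circleI) (auto intro!: continuous_intros)

lemma circle_of_real_surj: "\<exists>t. x = circle_of_real t"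
proof -
  have "circle_val x = cis (Arg (circle_val x))"
    using rcis_cmod_Arg[of "circle_val x"] by (simp add: rcis_def)
  then have "x = circle_of_real (Arg (circle_val x) / (2 * pi))"
    by (simp add: circle_val_inject[symmetric])
  then show ?thesis by blast
qed

lemma compact_UNIV_circle: "compact (UNIV :: circle set)"
proof -
  have "continuous_on (sphere 0 1) Abs_circle"
    by (rule continuous_on_circleI, subst continuous_on_cong[OF refl, of _ _ "\<lambda>z. z"])
      (auto simp: Abs_circle_inverse)
  then have "compact (Abs_circle ` sphere 0 1)"
    by (rule compact_continuous_image) auto
  moreover have "x \<in> Abs_circle ` sphere 0 1" for x
    by (rule image_eqI[of _ _ "circle_val x"]) (auto simp: circle_val_inverse)
  then have "Abs_circle ` sphere 0 1 = UNIV"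
    by auto
  ultimately show ?thesis
    by simp
qed

text \<open>The difference between \<open>g\<close> and its linear candidate is additive and vanishes at 1, hence
  on all rationals, which are dense.\<close>

lemma additive_continuous_real_linear:
  fixes g :: "real \<Rightarrow> 'a::real_normed_vector"
  assumes add: "\<And>s t. g (s + t) = g s + g t" and cont: "continuous_on UNIV g"
  shows "g t = t *\<^sub>R g 1"
proof -
  define h where "h t = g t - t *\<^sub>R g 1" for t
  have h_add: "h (s + t) = h s + h t" for s t
    by (simp add: h_def add scaleR_add_left)
  have [simp]: "h 1 = 0" "h 0 = 0"
    using h_add[of 0 0] by (simp_all add: h_def)
  have h_minus: "h (- t) = - h t" for t
    using h_add[of t "- t"] by (simp add: eq_neg_iff_add_eq_0 add.commute)
  have h_nat: "h (real n * t) = real n *\<^sub>R h t" for n t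
    by (induction n) (simp_all add: h_add distrib_right scaleR_add_left)
  have h_int: "h (of_int m * t) = of_int m *\<^sub>R h t" for m t
    by (cases m rule: int_cases2) (simp_all add: h_nat h_minus)
  have "h t = 0" if "t \<in> \<rat>" for t
    using that
  proof (cases rule: Rats_cases')
    case (1 a b)
    have "of_int b *\<^sub>R h t = h (of_int b * t)"
      by (simp only: h_int)
    also have "\<dots> = h (of_int a * 1)"
      using 1 by simp
    also have "\<dots> = 0"
      by (simp only: h_int) simp
    finally show ?thesis
      using 1 by simp
  qed
  moreover have "continuous_on (closure \<rat>) h"
    unfolding h_def by (intro continuous_intros continuous_on_subset[OF cont]) auto
  ultimately have "h t = 0"
    by (intro continuous_constant_on_closure[of "\<rat>" h 0 t]) (auto simp: Rats_closure_real)
  then show ?thesis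
    by (simp add: h_def)
qed

text \<open>A continuous logarithm \<open>g\<close> of \<open>f\<close> is additive up to an error in the discrete set of periods
  of \<open>exp\<close>. By connectedness the error is constant, so that \<open>g\<close> plus this constant is additive
  and therefore linear.\<close>

lemma continuous_unimodular_hom_eq_cis:
  fixes f :: "real \<Rightarrow> complex"
  assumes hom: "\<And>s t. f (s + t) = f s * f t" and norm: "\<And>t. cmod (f t) = 1"
    and cont: "continuous_on UNIV f"
  obtains c :: real where "\<And>t. f t = cis (c * t)"
proof -
  have nz: "f t \<noteq> 0" for t
    using norm[of t] by auto
  obtain g where g: "continuous_on UNIV g" "\<And>t. f t = exp (g t)"
    by (rule continuous_logarithm_on_contractible[OF cont contractible_UNIV]) (use nz in auto)
  \<comment> \<open>The defect of additivity, a function on the plane with values in the periods of \<open>exp\<close>.\<close>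
  define D where "D p = g (fst p + snd p) - g (fst p) - g (snd p)" for p
  have expD: "exp (D p) = 1" for p
    using hom[of "fst p" "snd p"] nz[of "fst p"] nz[of "snd p"]
    by (simp add: D_def exp_diff g)
  have "D constant_on UNIV"
  proof (rule continuous_discrete_range_constant)
    show "connected (UNIV :: (real \<times> real) set)"
      by (rule convex_connected) simp
    show "continuous_on UNIV D"
      unfolding D_def
      by (intro continuous_intros continuous_on_compose2[OF g(1)]) auto
    fix p :: "real \<times> real"
    have "2 * pi \<le> cmod (D q - D p)" if "D q \<noteq> D p" for q
    proof -
      have "exp (D q - D p) = 1"
        by (simp add: exp_diff expD)
      then obtain n :: int where n: "Re (D q - D p) = 0" "Im (D q - D p) = of_int (2 * n) * pi"
        by (auto simp: exp_eq_1)
      have "n \<noteq> 0"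
        using that n by (auto simp: complex_eq_iff)
      then have "2 * pi \<le> \<bar>Im (D q - D p)\<bar>"
        unfolding n by (simp add: abs_mult)
      also have "\<dots> \<le> cmod (D q - D p)"
        by (rule abs_Im_le_cmod)
      finally show ?thesis .
    qed
    then show "\<exists>e>0. \<forall>q. q \<in> UNIV \<and> D q \<noteq> D p \<longrightarrow> e \<le> norm (D q - D p)"
      by (intro exI[of _ "2 * pi"]) auto
  qed
  then obtain d where d: "\<And>s t. g (s + t) = g s + g t + d"
    unfolding constant_on_def D_def by (force simp: algebra_simps)
  have "exp d = 1"
  proof -
    have "d = - g 0"
      using d[of 0 0] by (simp add: eq_neg_iff_add_eq_0 add.commute)
    moreover have "exp (g 0) = 1"
      using hom[of 0 0] nz[of 0] by (auto simp: g)
    ultimately show ?thesis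
      by (simp add: exp_minus)
  qed
  have lin: "g t + d = t *\<^sub>R (g 1 + d)" for t
    by (rule additive_continuous_real_linear[where g = "\<lambda>t. g t + d"])
      (auto simp: d algebra_simps intro!: continuous_intros g)
  have f_eq: "f t = exp (t *\<^sub>R (g 1 + d))" for t
    using lin[of t] \<open>exp d = 1\<close> by (metis exp_add g(2) mult.right_neutral)
  have "Re (g 1 + d) = 0"
    using norm[of 1] f_eq[of 1] by simp
  then have "t *\<^sub>R (g 1 + d) = \<i> * of_real (Im (g 1 + d) * t)" for t
    by (simp add: complex_eq_iff)
  then have "f t = cis (Im (g 1 + d) * t)" for t
    using f_eq[of t] by (simp only: cis_conv_exp)
  then show thesis
    by (rule that)
qed

lemma character_add: "y \<in> characters \<Longrightarrow> y (a + b) = y a + y b"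
  by (simp add: characters_def)

lemma character_zero: "y \<in> characters \<Longrightarrow> y 0 = 0"
  using character_add[of y 0 0] by simp

lemma character_minus:
  assumes "y \<in> characters"
  shows "y (- a) = - y a"
proof -
  have "y (- a) + y a = 0"
    using character_add[OF assms, of "- a" a] character_zero[OF assms] by simp
  then show ?thesis
    by (simp only: eq_neg_iff_add_eq_0)
qed

lemma continuous_on_character: "y \<in> characters \<Longrightarrow> continuous_on S y"
  by (auto simp: characters_def intro: continuous_on_subset)

lemma characters_plus: "y \<in> characters \<Longrightarrow> z \<in> characters \<Longrightarrow> (\<lambda>x. y x + z x) \<in> characters"
  by (auto simp: characters_def intro!: continuous_on_add)

lemma characters_uminus: "y \<in> characters \<Longrightarrow> (\<lambda>x. - y x) \<in> characters"
  by (auto simp: characters_def intro!: continuous_on_minus)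

lemma character_compose:
  assumes "y \<in> characters" "\<And>a b. \<alpha> (a + b) = \<alpha> a + \<alpha> b" "continuous_on UNIV \<alpha>"
  shows "(\<lambda>x. y (\<alpha> x)) \<in> characters"
  unfolding characters_def
proof (intro CollectI conjI allI)
  show "continuous_on UNIV (\<lambda>x. y (\<alpha> x))"
    by (rule continuous_on_compose2[OF continuous_on_character[OF assms(1), of UNIV] assms(3)]) simp
qed (simp only: assms(2) character_add[OF assms(1)])

definition circle_character :: "int \<Rightarrow> circle \<Rightarrow> circle"
  where "circle_character k x = Abs_circle (circle_val x powi k)"

lemma circle_val_circle_character [simp]:
  "circle_val (circle_character k x) = circle_val x powi k"
  by (simp add: circle_character_def Abs_circle_inverse norm_power_int)

lemma circle_character_in_characters: "circle_character k \<in> characters"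
proof -
  have "continuous_on UNIV (circle_character k)"
  proof (rule continuous_on_circleI)
    show "continuous_on UNIV (\<lambda>x. circle_val (circle_character k x))"
      unfolding circle_val_circle_character
      by (intro continuous_on_power_int continuous_on_circle_val continuous_on_id) simp
  qed
  then show ?thesis
    by (simp add: characters_def circle_val_inject[symmetric] power_int_mult_distrib)
qed

lemmas circle_character_plus = character_add[OF circle_character_in_characters]
lemmas circle_character_uminus = character_minus[OF circle_character_in_characters]

lemma circle_character_add_index:
  "circle_character (k + l) x = circle_character k x + circle_character l x"
  by (simp add: circle_val_inject[symmetric] power_int_add)

lemma circle_character_minus_index: "circle_character (- k) x = - circle_character k x"
  by (simp add: circle_val_inject[symmetric] power_int_minus)

text \<open>Lifted to the real line along \<open>circle_of_real\<close>, a character becomes \<open>t \<mapsto> cis (c * t)\<close>, and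
  its value 1 at the period 1 forces \<open>c\<close> to be an integer multiple of \<open>2 * pi\<close>.\<close>

lemma circle_characterE:
  assumes y: "y \<in> characters"
  obtains k where "y = circle_character k"
proof -
  obtain c where c: "\<And>t. circle_val (y (circle_of_real t)) = cis (c * t)"
  proof (rule continuous_unimodular_hom_eq_cis[of "\<lambda>t. circle_val (y (circle_of_real t))"])
    show "continuous_on UNIV (\<lambda>t. circle_val (y (circle_of_real t)))"
      by (intro continuous_intros continuous_on_compose2[OF continuous_on_character[OF y, of UNIV]]) auto
  qed (auto simp: circle_of_real_add character_add[OF y])
  have "circle_of_real 1 = 0"
    by (simp add: circle_val_inject[symmetric])
  then have "cis c = 1"
    using c[of 1] by (simp add: character_zero[OF y])
  then have "cos c = 1"
    by (metis cis.sel(1) one_complex.sel(1))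
  then obtain k :: int where "c = of_int k * 2 * pi"
    by (auto simp: cos_one_2pi_int)
  then have "y (circle_of_real t) = circle_character k (circle_of_real t)" for t
    using c[of t] by (simp add: circle_val_inject[symmetric] cis_power_int mult_ac)
  then have "y x = circle_character k x" for x
    using circle_of_real_surj[of x] by blast
  then show thesis
    by (intro that) auto
qed

definition torus_character :: "int \<Rightarrow> int \<Rightarrow> torus2 \<Rightarrow> circle"
  where "torus_character m n x = circle_character m (fst x) + circle_character n (snd x)"

lemma torus_character_in_characters: "torus_character m n \<in> characters"
  unfolding torus_character_def[abs_def]
  by (intro characters_plus character_compose[OF circle_character_in_characters]
      continuous_on_fst continuous_on_snd continuous_on_id) simp_all

lemma torus_characterE:
  assumes y: "y \<in> characters"
  obtains m n where "y = torus_character m n"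
proof -
  have "(\<lambda>a. y (a, 0)) \<in> characters"
    by (rule character_compose[OF y]) (auto intro!: continuous_intros)
  from circle_characterE[OF this] obtain m where m: "(\<lambda>a. y (a, 0)) = circle_character m"
    by blast
  have "(\<lambda>b. y (0, b)) \<in> characters"
    by (rule character_compose[OF y]) (auto intro!: continuous_intros)
  from circle_characterE[OF this] obtain n where n: "(\<lambda>b. y (0, b)) = circle_character n"
    by blast
  have "y x = torus_character m n x" for x
    using character_add[OF y, of "(fst x, 0)" "(0, snd x)"] fun_cong[OF m, of "fst x"]
      fun_cong[OF n, of "snd x"]
    by (simp add: torus_character_def)
  then show thesis
    by (intro that) auto
qed

section \<open>Characteristic functions\<close>

lemma distributionsD:
  assumes "\<mu> \<in> distributions"
  shows "prob_space \<mu>" "sets \<mu> = sets borel" "space \<mu> = UNIV"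
  using assms by (auto simp: distributions_def dest: sets_eq_imp_space_eq)

lemma measurable_borel_distribution:
  "\<mu> \<in> distributions \<Longrightarrow> continuous_on UNIV f \<Longrightarrow> f \<in> measurable \<mu> borel"
  using measurable_cong_sets[OF distributionsD(2) refl] borel_measurable_continuous_onI by blast

lemma continuous_on_circle_val_character:
  "y \<in> characters \<Longrightarrow> continuous_on UNIV (\<lambda>x. circle_val (y x))"
  by (intro continuous_on_circle_val continuous_on_character)

lemma integrable_character:
  assumes "\<mu> \<in> distributions" "y \<in> characters"
  shows "integrable \<mu> (\<lambda>x. circle_val (y x))"
proof -
  interpret prob_space \<mu>
    using assms by (simp add: distributionsD)
  show ?thesis
    by (rule integrable_const_bound[of _ 1])
      (auto intro!: measurable_borel_distribution continuous_on_circle_val_character assms)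
qed

lemma characteristic_function_distr:
  assumes "\<mu> \<in> distributions" "y \<in> characters" "continuous_on UNIV f"
  shows "characteristic_function (distr \<mu> borel f) y = (LINT x|\<mu>. circle_val (y (f x)))"
  unfolding characteristic_function_def
  by (intro integral_distr measurable_borel_distribution assms borel_measurable_continuous_onI
      continuous_on_circle_val_character)

lemma distr_in_distributions:
  assumes "\<mu> \<in> distributions" "continuous_on UNIV f"
  shows "distr \<mu> borel f \<in> distributions"
  using prob_space.prob_space_distr[OF distributionsD(1)[OF assms(1)] measurable_borel_distribution[OF assms]]
  by (simp add: distributions_def)

lemma pair_in_distributions:
  fixes \<mu> :: "'a::second_countable_topology measure" and \<nu> :: "'b::second_countable_topology measure"
  assumes "\<mu> \<in> distributions" "\<nu> \<in> distributions"
  shows "\<mu> \<Otimes>\<^sub>M \<nu> \<in> distributions"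
proof -
  have "sets (\<mu> \<Otimes>\<^sub>M \<nu>) = sets borel"
    using sets_pair_measure_cong[OF distributionsD(2)[OF assms(1)] distributionsD(2)[OF assms(2)]]
    by (simp only: borel_prod)
  moreover have "prob_space (\<mu> \<Otimes>\<^sub>M \<nu>)"
  proof -
    interpret pair_prob_space \<mu> \<nu>
      using assms by (simp add: pair_prob_space_def pair_sigma_finite_def distributionsD
          prob_space_imp_sigma_finite)
    show ?thesis
      by unfold_locales
  qed
  ultimately show ?thesis
    by (simp add: distributions_def)
qed

lemma distr_pair_fst_borel:
  assumes \<mu>: "\<mu> \<in> distributions" and \<nu>: "\<nu> \<in> distributions"
  shows "distr (\<mu> \<Otimes>\<^sub>M \<nu>) borel fst = \<mu>"
proof (rule measure_eqI)
  interpret \<nu>: prob_space \<nu>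
    using \<nu> by (simp add: distributionsD)
  fix A assume "A \<in> sets (distr (\<mu> \<Otimes>\<^sub>M \<nu>) borel fst)"
  then have A: "A \<in> sets \<mu>"
    by (simp add: distributionsD[OF \<mu>])
  have "fst \<in> measurable (\<mu> \<Otimes>\<^sub>M \<nu>) borel"
    using measurable_fst measurable_cong_sets[OF refl distributionsD(2)[OF \<mu>]] by blast
  moreover have "fst -` A \<inter> space (\<mu> \<Otimes>\<^sub>M \<nu>) = A \<times> space \<nu>"
    by (auto simp: space_pair_measure distributionsD[OF \<mu>])
  ultimately show "emeasure (distr (\<mu> \<Otimes>\<^sub>M \<nu>) borel fst) A = emeasure \<mu> A"
    using A \<nu>.emeasure_space_1
    by (simp add: emeasure_distr distributionsD[OF \<mu>] \<nu>.emeasure_pair_measure_Times)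
qed (simp add: distributionsD[OF \<mu>])

lemma distr_pair_snd_borel:
  assumes \<mu>: "\<mu> \<in> distributions" and \<nu>: "\<nu> \<in> distributions"
  shows "distr (\<mu> \<Otimes>\<^sub>M \<nu>) borel snd = \<nu>"
proof (rule measure_eqI)
  interpret \<mu>: prob_space \<mu>
    using \<mu> by (simp add: distributionsD)
  interpret \<nu>: prob_space \<nu>
    using \<nu> by (simp add: distributionsD)
  fix A assume "A \<in> sets (distr (\<mu> \<Otimes>\<^sub>M \<nu>) borel snd)"
  then have A: "A \<in> sets \<nu>"
    by (simp add: distributionsD[OF \<nu>])
  have "snd \<in> measurable (\<mu> \<Otimes>\<^sub>M \<nu>) borel"
    using measurable_snd measurable_cong_sets[OF refl distributionsD(2)[OF \<nu>]] by blast
  moreover have "snd -` A \<inter> space (\<mu> \<Otimes>\<^sub>M \<nu>) = space \<mu> \<times> A"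
    by (auto simp: space_pair_measure distributionsD[OF \<nu>])
  ultimately show "emeasure (distr (\<mu> \<Otimes>\<^sub>M \<nu>) borel snd) A = emeasure \<nu> A"
    using A \<mu>.emeasure_space_1
    by (simp add: emeasure_distr distributionsD[OF \<nu>] \<nu>.emeasure_pair_measure_Times)
qed (simp add: distributionsD[OF \<nu>])

lemma indep_var_pair_fst_snd:
  fixes \<mu> \<nu> :: "'a::second_countable_topology measure"
  assumes \<mu>: "\<mu> \<in> distributions" and \<nu>: "\<nu> \<in> distributions"
  shows "prob_space.indep_var (\<mu> \<Otimes>\<^sub>M \<nu>) borel fst borel snd"
proof -
  note M = pair_in_distributions[OF assms]
  interpret prob_space "\<mu> \<Otimes>\<^sub>M \<nu>"
    by (rule distributionsD[OF M])
  have "distr (\<mu> \<Otimes>\<^sub>M \<nu>) (borel \<Otimes>\<^sub>M borel) (\<lambda>w. (fst w, snd w)) = \<mu> \<Otimes>\<^sub>M \<nu>"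
    unfolding borel_prod prod.collapse
    by (rule distr_id2) (rule distributionsD(2)[OF M, symmetric])
  then show ?thesis
    unfolding indep_var_distribution_eq distr_pair_fst_borel[OF assms] distr_pair_snd_borel[OF assms]
    by (auto intro!: measurable_borel_distribution[OF M] continuous_intros)
qed

text \<open>Fubini's theorem, in a form that serves convolutions, product distributions and linear
  forms in independent variables alike.\<close>

lemma integral_pair_characters:
  fixes \<mu> :: "'a::{topological_ab_group_add, second_countable_topology} measure"
    and \<nu> :: "'b::{topological_ab_group_add, second_countable_topology} measure"
  assumes \<mu>: "\<mu> \<in> distributions" and \<nu>: "\<nu> \<in> distributions"
    and y: "y \<in> characters" and z: "z \<in> characters"
  shows "(LINT w|(\<mu> \<Otimes>\<^sub>M \<nu>). circle_val (y (fst w) + z (snd w))) =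
    characteristic_function \<mu> y * characteristic_function \<nu> z"
proof -
  interpret pair_prob_space \<mu> \<nu>
    using assms by (simp add: pair_prob_space_def pair_sigma_finite_def distributionsD
        prob_space_imp_sigma_finite)
  have "continuous_on UNIV (\<lambda>w. circle_val (y (fst w) + z (snd w)))"
    by (intro continuous_on_circle_val continuous_on_add
        continuous_on_compose2[OF continuous_on_character[OF y, of UNIV]]
        continuous_on_compose2[OF continuous_on_character[OF z, of UNIV]]
        continuous_on_fst continuous_on_snd continuous_on_id) simp_all
  then have "integrable (\<mu> \<Otimes>\<^sub>M \<nu>) (\<lambda>w. circle_val (y (fst w) + z (snd w)))"
    by (intro P.integrable_const_bound[of _ 1] measurable_borel_distribution
        pair_in_distributions \<mu> \<nu>) (simp_all only: norm_circle_val, simp)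
  from integral_fst'[OF this] show ?thesis
    by (simp add: characteristic_function_def)
qed

lemma characteristic_function_group_convolution:
  fixes \<mu> \<nu> :: "'a::{topological_ab_group_add, second_countable_topology} measure"
  assumes "\<mu> \<in> distributions" "\<nu> \<in> distributions" and y: "y \<in> characters"
  shows "characteristic_function (group_convolution \<mu> \<nu>) y =
    characteristic_function \<mu> y * characteristic_function \<nu> y"
proof -
  have "continuous_on UNIV (\<lambda>w :: 'a \<times> 'a. fst w + snd w)"
    by (intro continuous_intros)
  from characteristic_function_distr[OF pair_in_distributions[OF assms(1,2)] y this] show ?thesis
    unfolding group_convolution_def case_prod_beta character_add[OF y]
    by (simp only: integral_pair_characters[OF assms y])
qed

section \<open>Uniqueness of a distribution with given characteristic function\<close>

inductive trigonometric_polynomial :: "('a::topological_ab_group_add \<Rightarrow> complex) \<Rightarrow> bool"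
  where
    character: "y \<in> characters \<Longrightarrow> trigonometric_polynomial (\<lambda>x. c * circle_val (y x))"
  | add: "trigonometric_polynomial p \<Longrightarrow> trigonometric_polynomial q \<Longrightarrow>
      trigonometric_polynomial (\<lambda>x. p x + q x)"

lemma trigonometric_polynomial_mult:
  assumes "trigonometric_polynomial p" "trigonometric_polynomial q"
  shows "trigonometric_polynomial (\<lambda>x. p x * q x)"
  using assms(1)
proof induction
  case (character y c)
  note y = character
  show ?case
    using assms(2)
  proof induction
    case (character z d)
    show ?case
      using trigonometric_polynomial.character[OF characters_plus[OF y character], of "c * d"]
      by (simp add: mult_ac)
  next
    case (add p q)
    then show ?case
      using trigonometric_polynomial.add[OF add.IH] by (simp add: distrib_left)
  qed
next
  case (add p q)
  then show ?case
    using trigonometric_polynomial.add[OF add.IH] by (simp add: distrib_right)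
qed

lemma trigonometric_polynomial_cnj:
  "trigonometric_polynomial p \<Longrightarrow> trigonometric_polynomial (\<lambda>x. cnj (p x))"
proof (induction rule: trigonometric_polynomial.induct)
  case (character y c)
  have "cnj (circle_val u) = circle_val (- u)" for u
    by (simp add: inverse_complex_def complex_eq_iff) (simp flip: cmod_power2)
  then show ?case
    using trigonometric_polynomial.character[OF characters_uminus[OF character], of "cnj c"]
    by simp
qed (simp add: trigonometric_polynomial.add)

lemma trigonometric_polynomial_const: "trigonometric_polynomial (\<lambda>x. c)"
  using trigonometric_polynomial.character[of "\<lambda>x. 0" c] by (simp add: characters_def)

lemma continuous_on_trigonometric_polynomial:
  "trigonometric_polynomial p \<Longrightarrow> continuous_on UNIV p"
  by (induction rule: trigonometric_polynomial.induct)
    (auto intro!: continuous_on_add continuous_on_mult continuous_on_circle_val_character)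

text \<open>Stone--Weierstrass for the algebra of real parts of trigonometric polynomials. It is closed
  under products because \<open>2 * Re a * Re b = Re (a * b + a * cnj b)\<close>.\<close>

lemma trigonometric_polynomials_dense:
  fixes f :: "'a::{t2_space, topological_ab_group_add} \<Rightarrow> real"
  assumes comp: "compact (UNIV :: 'a set)"
    and sep: "\<And>a b :: 'a. a \<noteq> b \<Longrightarrow> \<exists>y\<in>characters. y a \<noteq> y b"
    and f: "continuous_on UNIV f" and e: "0 < e"
  obtains p where "trigonometric_polynomial p" "\<And>x. \<bar>f x - Re (p x)\<bar> < e"
proof -
  define R where "R = {\<lambda>x. Re (p x) | p :: 'a \<Rightarrow> complex. trigonometric_polynomial p}"
  have "function_ring_on R UNIV"
  proof
    show "compact (UNIV :: 'a set)"
      by (rule comp)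
    show "continuous_on UNIV g" if "g \<in> R" for g
      using that by (auto simp: R_def intro!: continuous_on_Re continuous_on_trigonometric_polynomial)
    show "(\<lambda>x. g x + h x) \<in> R" if gh: "g \<in> R" "h \<in> R" for g h
    proof -
      obtain p q where pq: "trigonometric_polynomial p" "trigonometric_polynomial q"
        "g = (\<lambda>x. Re (p x))" "h = (\<lambda>x. Re (q x))"
        using gh by (auto simp: R_def)
      show ?thesis
        unfolding R_def by (intro CollectI exI[of _ "\<lambda>x. p x + q x"])
          (simp add: pq trigonometric_polynomial.add)
    qed
    show "(\<lambda>x. g x * h x) \<in> R" if gh: "g \<in> R" "h \<in> R" for g h
    proof -
      obtain p q where pq: "trigonometric_polynomial p" "trigonometric_polynomial q"
        "g = (\<lambda>x. Re (p x))" "h = (\<lambda>x. Re (q x))"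
        using gh by (auto simp: R_def)
      have "Re a * Re b = Re (1 / 2 * (a * b + a * cnj b))" for a b
        by simp
      then show ?thesis
        unfolding R_def
        by (intro CollectI exI[of _ "\<lambda>x. 1 / 2 * (p x * q x + p x * cnj (q x))"] conjI)
          (simp_all only: pq trigonometric_polynomial.add trigonometric_polynomial_mult
            trigonometric_polynomial_cnj trigonometric_polynomial_const)
    qed
    show "(\<lambda>_. c) \<in> R" for c
      unfolding R_def
      by (intro CollectI exI[of _ "\<lambda>x. of_real c"]) (simp add: trigonometric_polynomial_const)
    fix a b :: 'a
    assume "a \<noteq> b"
    then obtain y where y: "y \<in> characters" "y a \<noteq> y b"
      using sep by blast
    \<comment> \<open>The factor \<open>- \<i>\<close> turns imaginary parts into real parts.\<close>
    have tp: "trigonometric_polynomial (\<lambda>x. c * circle_val (y x))" for c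
      by (rule trigonometric_polynomial.character) fact
    have R1: "(\<lambda>x. Re (c * circle_val (y x))) \<in> R" for c
      unfolding R_def by (rule CollectI, rule exI, rule conjI[OF refl tp])
    have "circle_val (y a) \<noteq> circle_val (y b)"
      using y(2) by (simp add: circle_val_inject)
    then have "Re (1 * circle_val (y a)) \<noteq> Re (1 * circle_val (y b)) \<or>
        Re (- \<i> * circle_val (y a)) \<noteq> Re (- \<i> * circle_val (y b))"
      by (simp add: complex_eq_iff)
    then show "\<exists>f\<in>R. f a \<noteq> f b"
    proof
      assume "Re (1 * circle_val (y a)) \<noteq> Re (1 * circle_val (y b))"
      then show ?thesis
        by (rule bexI[OF _ R1[of 1]])
    next
      assume "Re (- \<i> * circle_val (y a)) \<noteq> Re (- \<i> * circle_val (y b))"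
      then show ?thesis
        by (rule bexI[OF _ R1[of "- \<i>"]])
    qed
  qed
  then interpret function_ring_on R UNIV .
  show thesis
    using Stone_Weierstrass_basic[OF f e] that by (auto simp: R_def)
qed

lemma integrable_continuous_compact:
  fixes f :: "'a::topological_space \<Rightarrow> 'b::{banach, second_countable_topology}"
  assumes \<mu>: "\<mu> \<in> distributions" and comp: "compact (UNIV :: 'a set)" and f: "continuous_on UNIV f"
  shows "integrable \<mu> f"
proof -
  interpret prob_space \<mu>
    using \<mu> by (simp add: distributionsD)
  obtain B where "\<And>x. norm (f x) \<le> B"
    using compact_imp_bounded[OF compact_continuous_image[OF f comp]]
    by (auto simp: bounded_iff)
  then show ?thesis
    by (intro integrable_const_bound[of _ B] measurable_borel_distribution \<mu> f) simp
qed

lemma integral_trigonometric_polynomial_eq: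
  fixes \<mu> \<nu> :: "'a::topological_ab_group_add measure"
  assumes \<mu>: "\<mu> \<in> distributions" and \<nu>: "\<nu> \<in> distributions"
    and comp: "compact (UNIV :: 'a set)"
    and eq: "\<And>y. y \<in> characters \<Longrightarrow> characteristic_function \<mu> y = characteristic_function \<nu> y"
    and p: "trigonometric_polynomial p"
  shows "(LINT x|\<mu>. p x) = (LINT x|\<nu>. p x)"
  using p
proof induction
  case (character y c)
  then show ?case
    using eq[OF character] by (simp add: characteristic_function_def)
next
  case (add p q)
  then show ?case
    by (simp add: integrable_continuous_compact[OF _ comp continuous_on_trigonometric_polynomial] \<mu> \<nu>)
qed

text \<open>The indicator of an open set is the increasing limit of truncated multiples of the distance to
  the complement, and open sets generate the Borel sets.\<close>

lemma distribution_eqI_integral_continuous: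
  fixes \<mu> \<nu> :: "'a::metric_space measure"
  assumes \<mu>: "\<mu> \<in> distributions" and \<nu>: "\<nu> \<in> distributions"
    and eq: "\<And>f :: 'a \<Rightarrow> real. continuous_on UNIV f \<Longrightarrow> (\<And>x. 0 \<le> f x \<and> f x \<le> 1) \<Longrightarrow>
      (LINT x|\<mu>. f x) = (LINT x|\<nu>. f x)"
  shows "\<mu> = \<nu>"
proof -
  interpret \<mu>: prob_space \<mu>
    using \<mu> by (simp add: distributionsD)
  interpret \<nu>: prob_space \<nu>
    using \<nu> by (simp add: distributionsD)
  have measure_eq: "measure \<mu> U = measure \<nu> U" if U: "open U" for U
  proof (cases "U = UNIV")
    case True
    then show ?thesis
      using \<mu>.prob_space \<nu>.prob_space by (simp add: distributionsD \<mu> \<nu>)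
  next
    case False
    define f where "f n x = min 1 (real n * infdist x (- U))" for n x
    have f01: "0 \<le> f n x \<and> f n x \<le> 1" for n x
      by (simp add: f_def infdist_nonneg)
    have cont: "continuous_on UNIV (f n)" for n
      unfolding f_def by (intro continuous_on_min continuous_on_mult continuous_on_const
          continuous_on_infdist continuous_on_id)
    have f_lim: "(\<lambda>n. f n x) \<longlonglongrightarrow> indicator U x" for x
    proof (cases "x \<in> U")
      case True
      then have "infdist x (- U) \<noteq> 0"
        using in_closed_iff_infdist_zero[of "- U" x] U False by auto
      then have pos: "infdist x (- U) > 0"
        using infdist_nonneg[of x "- U"] by linarith
      obtain N :: nat where N: "1 < real N * infdist x (- U)"
        using reals_Archimedean3[OF pos] by blast
      have "f n x = 1" if "n \<ge> N" for n
      proof -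
        have "real N * infdist x (- U) \<le> real n * infdist x (- U)"
          using that pos by (intro mult_right_mono) auto
        then show ?thesis
          using N by (simp add: f_def)
      qed
      then have "eventually (\<lambda>n. f n x = indicator U x) sequentially"
        using True by (auto simp: eventually_sequentially)
      then show ?thesis
        by (rule tendsto_eventually)
    next
      case False
      then show ?thesis
        by (simp add: f_def)
    qed
    have lim: "(\<lambda>n. LINT x|\<rho>. f n x) \<longlonglongrightarrow> measure \<rho> U" if \<rho>: "\<rho> \<in> distributions" for \<rho>
    proof -
      interpret \<rho>: prob_space \<rho>
        using \<rho> by (simp add: distributionsD)
      have sets: "U \<in> sets \<rho>"
        using U by (simp add: distributionsD(2)[OF \<rho>])
      have "(\<lambda>n. LINT x|\<rho>. f n x) \<longlonglongrightarrow> (LINT x|\<rho>. indicator U x)"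
      proof (rule integral_dominated_convergence[where w = "\<lambda>_. 1"])
        show "f n \<in> borel_measurable \<rho>" for n
          by (rule measurable_borel_distribution[OF \<rho> cont])
        show "indicat_real U \<in> borel_measurable \<rho>"
          using sets by simp
      qed (use f01 f_lim in auto)
      then show ?thesis
        using sets by (simp add: distributionsD \<rho>)
    qed
    show ?thesis
      using lim[OF \<mu>] lim[OF \<nu>] eq[OF cont f01] by (auto intro: LIMSEQ_unique)
  qed
  show ?thesis
  proof (rule measure_eqI_generator_eq[where E = "{S. open S}" and \<Omega> = UNIV and A = "\<lambda>_. UNIV"])
    show "Int_stable {S :: 'a set. open S}"
      by (auto simp: Int_stable_def)
    show "emeasure \<mu> U = emeasure \<nu> U" if "U \<in> {S. open S}" for U
      using measure_eq that by (simp add: \<mu>.emeasure_eq_measure \<nu>.emeasure_eq_measure)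
  qed (use distributionsD(2)[OF \<mu>] distributionsD(2)[OF \<nu>] in \<open>auto simp: borel_def\<close>)
qed

text \<open>Equal characteristic functions give equal integrals of trigonometric polynomials, and these
  approximate every continuous function uniformly.\<close>

lemma distribution_eqI_characteristic_function:
  fixes \<mu> \<nu> :: "'a::{metric_space, topological_ab_group_add} measure"
  assumes \<mu>: "\<mu> \<in> distributions" and \<nu>: "\<nu> \<in> distributions"
    and comp: "compact (UNIV :: 'a set)"
    and sep: "\<And>a b :: 'a. a \<noteq> b \<Longrightarrow> \<exists>y\<in>characters. y a \<noteq> y b"
    and eq: "\<And>y. y \<in> characters \<Longrightarrow> characteristic_function \<mu> y = characteristic_function \<nu> y"
  shows "\<mu> = \<nu>"
proof (rule distribution_eqI_integral_continuous[OF \<mu> \<nu>])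
  fix f :: "'a \<Rightarrow> real"
  assume f: "continuous_on UNIV f"
  have "\<bar>(LINT x|\<mu>. f x) - (LINT x|\<nu>. f x)\<bar> \<le> e" if e: "0 < e" for e
  proof -
    obtain p where p: "trigonometric_polynomial p" "\<And>x. \<bar>f x - Re (p x)\<bar> < e / 2"
      using trigonometric_polynomials_dense[OF comp sep f, of "e / 2"] e by auto
    have close: "\<bar>(LINT x|\<rho>. f x) - Re (LINT x|\<rho>. p x)\<bar> \<le> e / 2" if \<rho>: "\<rho> \<in> distributions" for \<rho>
    proof -
      interpret \<rho>: prob_space \<rho>
        using \<rho> by (simp add: distributionsD)
      note int = integrable_continuous_compact[OF \<rho> comp]
      have ip: "integrable \<rho> p"
        by (intro int continuous_on_trigonometric_polynomial p)
      have "(LINT x|\<rho>. f x) - Re (LINT x|\<rho>. p x) = (LINT x|\<rho>. f x - Re (p x))"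
        using ip int[OF f] by simp
      also have "\<bar>\<dots>\<bar> \<le> (LINT x|\<rho>. \<bar>f x - Re (p x)\<bar>)"
        by (rule integral_abs_bound)
      also have "\<dots> \<le> (LINT x|\<rho>. e / 2)"
        using ip int[OF f] p(2) by (intro integral_mono) (auto intro: less_imp_le)
      finally show ?thesis
        by (simp add: \<rho>.prob_space)
    qed
    have "Re (LINT x|\<mu>. p x) = Re (LINT x|\<nu>. p x)"
      using integral_trigonometric_polynomial_eq[OF \<mu> \<nu> comp eq p(1)] by simp
    then show ?thesis
      using close[OF \<mu>] close[OF \<nu>] by linarith
  qed
  then have "\<bar>(LINT x|\<mu>. f x) - (LINT x|\<nu>. f x)\<bar> \<le> 0"
    by (rule field_le_epsilon) simp
  then show "(LINT x|\<mu>. f x) = (LINT x|\<nu>. f x)"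
    by simp
qed

section \<open>Gaussian distributions convolved with distributions on a group of exponent two\<close>

text \<open>A doubled character is trivial on all elements of order dividing two, so integrating it against
  a distribution on such elements gives 1.\<close>

lemma characteristic_function_exponent_two:
  assumes \<omega>: "\<omega> \<in> distributions_on G" and G: "\<And>x. x \<in> G \<Longrightarrow> x + x = 0" and y: "y \<in> characters"
  shows "characteristic_function \<omega> (\<lambda>x. y x + y x) = 1"
proof -
  have \<omega>': "\<omega> \<in> distributions" "measure \<omega> G = 1"
    using \<omega> by (auto simp: distributions_on_def)
  interpret prob_space \<omega>
    using \<omega>' by (simp add: distributionsD)
  have "G \<in> events"
    using \<omega>'(2) measure_notin_sets[of G \<omega>] by auto
  then have "AE x in \<omega>. x \<in> G"
    using \<omega>'(2) by (simp add: prob_eq_1[symmetric])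
  then have "AE x in \<omega>. circle_val (y x + y x) = 1"
  proof eventually_elim
    case (elim x)
    have "y x + y x = 0"
      using character_add[OF y, of x x] G[OF elim] character_zero[OF y] by simp
    then show ?case
      by simp
  qed
  then have "(LINT x|\<omega>. circle_val (y x + y x)) = (LINT x|\<omega>. 1)"
    using integrable_character[OF \<omega>'(1) characters_plus[OF y y]]
    by (intro integral_cong_AE) auto
  then show ?thesis
    by (simp add: characteristic_function_def prob_space)
qed

lemma norm_characteristic_function_le_1:
  assumes "\<mu> \<in> distributions" "y \<in> characters"
  shows "cmod (characteristic_function \<mu> y) \<le> 1"
proof -
  interpret prob_space \<mu>
    using assms by (simp add: distributionsD)
  have "cmod (characteristic_function \<mu> y) \<le> (LINT x|\<mu>. cmod (circle_val (y x)))"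
    unfolding characteristic_function_def by (rule integral_norm_bound)
  then show ?thesis
    by (simp add: prob_space)
qed

text \<open>The obstruction to membership. The quadratic form of the Gaussian factor satisfies
  \<open>\<phi> (2 y) = 4 * \<phi> y\<close>; the other factor has modulus at most 1 at \<open>y\<close> and equals 1 at \<open>2 y\<close>.\<close>

lemma gaussian_conv_norm_characteristic_function:
  fixes \<mu> :: "'a::{topological_ab_group_add, second_countable_topology} measure"
  assumes \<mu>: "\<mu> \<in> gaussian_conv G" and G: "\<And>x. x \<in> G \<Longrightarrow> x + x = 0" and y: "y \<in> characters"
  shows "cmod (characteristic_function \<mu> y) ^ 4 \<le> cmod (characteristic_function \<mu> (\<lambda>x. y x + y x))"
proof -
  obtain \<gamma> \<omega> where \<mu>_eq: "\<mu> = group_convolution \<gamma> \<omega>"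
    and \<gamma>: "\<gamma> \<in> gaussian_distributions" and \<omega>: "\<omega> \<in> distributions_on G"
    using \<mu> by (auto simp: gaussian_conv_def)
  have \<gamma>': "\<gamma> \<in> distributions" and \<omega>': "\<omega> \<in> distributions"
    using \<gamma> \<omega> by (auto simp: gaussian_distributions_def distributions_on_def)
  obtain \<phi> x where
    quad: "\<And>u v. u \<in> characters \<Longrightarrow> v \<in> characters \<Longrightarrow>
      \<phi> (\<lambda>t. u t + v t) + \<phi> (\<lambda>t. u t - v t) = 2 * (\<phi> u + \<phi> v)" and
    cf: "\<And>y. y \<in> characters \<Longrightarrow>
      characteristic_function \<gamma> y = circle_val (y x) * complex_of_real (exp (- \<phi> y))"
    using \<gamma> unfolding gaussian_distributions_def by blast
  have zero: "(\<lambda>t. 0) \<in> (characters :: ('a \<Rightarrow> circle) set)"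
    by (simp add: characters_def)
  have yy: "(\<lambda>x. y x + y x) \<in> characters"
    by (intro characters_plus y)
  have "\<phi> (\<lambda>t. 0) = 0"
    using quad[OF zero zero] by simp
  then have "\<phi> (\<lambda>x. y x + y x) = 4 * \<phi> y"
    using quad[OF y y] by simp
  then have "cmod (characteristic_function \<mu> (\<lambda>x. y x + y x)) = exp (- \<phi> y) ^ 4"
    by (simp add: \<mu>_eq characteristic_function_group_convolution[OF \<gamma>' \<omega>' yy] cf[OF yy]
        characteristic_function_exponent_two[OF \<omega> G y] norm_mult exp_of_nat_mult[symmetric])
  moreover have "cmod (characteristic_function \<mu> y) \<le> exp (- \<phi> y)"
    using norm_characteristic_function_le_1[OF \<omega>' y]
    by (simp add: \<mu>_eq characteristic_function_group_convolution[OF \<gamma>' \<omega>' y] cf[OF y] norm_mult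
        mult_left_le)
  ultimately show ?thesis
    by (simp add: power_mono)
qed

section \<open>Distributions on the circle with prescribed Fourier coefficients\<close>

definition unit_interval_exp :: "int \<Rightarrow> real \<Rightarrow> complex"
  where "unit_interval_exp k t = indicator {0..1} t *\<^sub>R cis (2 * pi * of_int k * t)"

lemma has_bochner_integral_unit_interval_exp:
  "has_bochner_integral lborel (unit_interval_exp k) (if k = 0 then 1 else 0)"
proof (cases "k = 0")
  case True
  have "has_bochner_integral lborel (\<lambda>t. indicator {0..1::real} t *\<^sub>R (1 :: complex)) (of_real 1 - of_real 0)"
    by (rule has_bochner_integral_FTC_Icc) (auto intro!: derivative_eq_intros)
  then show ?thesis
    using True by (simp add: unit_interval_exp_def[abs_def])
next
  case False
  define c where "c = 2 * pi * of_int k"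
  have c: "c \<noteq> 0"
    using False by (simp add: c_def)
  have "has_bochner_integral lborel (\<lambda>t. indicator {0..1::real} t *\<^sub>R cis (c * t))
      (- \<i> / c * cis (c * 1) - - \<i> / c * cis (c * 0))"
  proof (rule has_bochner_integral_FTC_Icc)
    fix t :: real
    show "((\<lambda>t. - \<i> / c * cis (c * t)) has_vector_derivative cis (c * t)) (at t within {0..1})"
    proof -
      have "((\<lambda>z. - \<i> / c * exp (\<i> * (c * z))) has_field_derivative exp (\<i> * (c * of_real t)))
          (at (of_real t))"
        using c by (auto intro!: derivative_eq_intros)
      from has_vector_derivative_real_field[OF this, of "{0..1}"] show ?thesis
        by (simp add: cis_conv_exp)
    qed
  qed (auto intro!: continuous_intros)
  moreover have "cis c = 1"
    using cis_multiple_2pi[of "of_int k"] by (simp add: c_def mult_ac)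
  ultimately show ?thesis
    using False by (simp add: unit_interval_exp_def[abs_def] c_def)
qed

lemma norm_unit_interval_exp: "cmod (unit_interval_exp k t) = indicator {0..1} t"
  by (simp add: unit_interval_exp_def)

text \<open>The distribution has density \<open>1 + (\<Sum>n. 2 * r (n + 1) * cos (2 * pi * (n + 1) * t))\<close> with respect
  to Lebesgue measure on the unit interval. The bound on the coefficients keeps the density
  nonnegative and allows integration term by term.\<close>

lemma circle_distribution_with_coefficients:
  fixes r :: "int \<Rightarrow> real"
  assumes r0: "r 0 = 1" and sym: "\<And>k. r (- k) = r k"
    and summ: "summable (\<lambda>n. \<bar>r (int (Suc n))\<bar>)" and le: "(\<Sum>n. \<bar>r (int (Suc n))\<bar>) \<le> 1 / 2"
  obtains \<rho> where "\<rho> \<in> distributions"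
    "\<And>k. characteristic_function \<rho> (circle_character k) = of_real (r k)"
proof -
  define s where "s n = r (int (Suc n))" for n
  have summ_s: "summable (\<lambda>n. \<bar>s n\<bar>)" and le_s: "(\<Sum>n. \<bar>s n\<bar>) \<le> 1 / 2"
    using summ le by (simp_all add: s_def)
  define d where "d t = 1 + (\<Sum>n. 2 * s n * cos (2 * pi * Suc n * t))" for t :: real
  have summ_abs: "summable (\<lambda>n. \<bar>2 * s n * cos (2 * pi * Suc n * t)\<bar>)" for t
    by (rule summable_comparison_test'[OF summable_mult[OF summ_s, of 2], of 0])
      (auto simp: abs_mult intro!: mult_left_le)
  have d_nonneg: "0 \<le> d t" for t
  proof -
    have "\<bar>\<Sum>n. 2 * s n * cos (2 * pi * Suc n * t)\<bar> \<le> (\<Sum>n. \<bar>2 * s n * cos (2 * pi * Suc n * t)\<bar>)"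
      by (rule summable_rabs[OF summ_abs])
    also have "\<dots> \<le> (\<Sum>n. 2 * \<bar>s n\<bar>)"
      by (intro suminf_le summ_abs summable_mult summ_s) (auto simp: abs_mult intro!: mult_left_le)
    also have "\<dots> \<le> 1"
      using le_s summ_s by (simp add: suminf_mult)
    finally show ?thesis
      by (simp add: d_def)
  qed
  have d_meas [measurable]: "d \<in> borel_measurable borel"
    unfolding d_def[abs_def] by measurable
  define f where "f t = indicator {0..1} t * d t" for t :: real
  have f_meas [measurable]: "f \<in> borel_measurable borel"
    unfolding f_def[abs_def] by measurable
  have f_nonneg: "0 \<le> f t" for t
    by (simp add: f_def d_nonneg)
  have coeff: "has_bochner_integral lborel (\<lambda>t. f t *\<^sub>R cis (2 * pi * of_int k * t)) (of_real (r k))" for k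
  proof -
    \<comment> \<open>The \<open>n\<close>-th term of the density times the exponential, split by Euler's formula into two
        exponentials.\<close>
    define F where "F n t = s n *\<^sub>R (unit_interval_exp (k + int (Suc n)) t + unit_interval_exp (k - int (Suc n)) t)" for n t
    define I where "I n = s n *\<^sub>R ((if k + int (Suc n) = 0 then 1 else 0) +
      (if k - int (Suc n) = 0 then 1 else 0 :: complex))" for n
    have F_int: "has_bochner_integral lborel (F n) (I n)" for n
      unfolding F_def I_def
      by (intro has_bochner_integral_scaleR_right has_bochner_integral_add
          has_bochner_integral_unit_interval_exp)
    have norm_F: "norm (F n t) \<le> 2 * \<bar>s n\<bar> * indicator {0..1} t" for n t
      unfolding F_def norm_scaleR
      using norm_triangle_ineq[of "unit_interval_exp (k + int (Suc n)) t" "unit_interval_exp (k - int (Suc n)) t"]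
      by (simp add: norm_unit_interval_exp mult_left_mono mult.assoc mult.left_commute)
    have summ_2s: "summable (\<lambda>n. 2 * \<bar>s n\<bar>)"
      by (intro summable_mult summ_s)
    have summ_F: "summable (\<lambda>n. norm (F n t))" for t
      by (rule summable_comparison_test'[OF summable_mult2[OF summ_2s], of 0 _ "indicator {0..1} t"])
        (simp add: norm_F)
    have summ_int: "summable (\<lambda>n. LINT t|lborel. norm (F n t))"
    proof (rule summable_comparison_test'[OF summ_2s, of 0])
      fix n :: nat
      have "(LINT t|lborel. norm (F n t)) \<le> (LINT t|lborel. 2 * \<bar>s n\<bar> * indicator {0..1::real} t)"
        using F_int[of n] by (intro integral_mono integrable_norm norm_F)
          (auto simp: has_bochner_integral_iff)
      then show "norm (LINT t|lborel. norm (F n t)) \<le> 2 * \<bar>s n\<bar>"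
        by simp
    qed
    have int_F: "integrable lborel (F n)" for n
      using F_int by (simp add: has_bochner_integral_iff)
    have "I sums (LINT t|lborel. (\<Sum>n. F n t))"
      using sums_integral[OF int_F, OF _ summ_int] summ_F F_int by (simp add: has_bochner_integral_iff)
    moreover have "I sums (if k = 0 then 0 else of_real (r k))"
    proof (cases "k = 0")
      case False
      \<comment> \<open>Only the term with \<open>n + 1 = \<bar>k\<bar>\<close> contributes.\<close>
      define N where "N = nat (\<bar>k\<bar> - 1)"
      have N: "int (Suc N) = \<bar>k\<bar>"
        using False by (simp add: N_def)
      have "I n = (if n = N then of_real (r k) else 0)" for n
      proof (cases "n = N")
        case True
        have "r \<bar>k\<bar> = r k"
          by (cases "0 \<le> k") (simp_all add: sym)
        then show ?thesis
          using True N \<open>k \<noteq> 0\<close>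
          by (cases "0 \<le> k") (simp_all del: of_nat_Suc add: I_def s_def scaleR_conv_of_real)
      next
        case False
        then have "int (Suc n) \<noteq> k" "int (Suc n) \<noteq> - k"
          using N by linarith+
        then have "k + int (Suc n) \<noteq> 0" "k - int (Suc n) \<noteq> 0"
          by linarith+
        then show ?thesis
          using False by (simp only: I_def if_False) simp
      qed
      then have "I = (\<lambda>n. if n = N then of_real (r k) else 0)"
        by (rule ext)
      then show ?thesis
        using sums_single[of N "\<lambda>_. of_real (r k) :: complex"] False by simp
    qed (simp del: of_nat_Suc add: I_def[abs_def])
    ultimately have "(LINT t|lborel. (\<Sum>n. F n t)) = (if k = 0 then 0 else of_real (r k))"
      by (rule sums_unique2)
    moreover have "integrable lborel (\<lambda>t. \<Sum>n. F n t)"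
      by (rule integrable_suminf[OF int_F _ summ_int]) (simp add: summ_F)
    ultimately have "has_bochner_integral lborel (\<lambda>t. \<Sum>n. F n t) (if k = 0 then 0 else of_real (r k))"
      by (simp add: has_bochner_integral_iff)
    from has_bochner_integral_add[OF has_bochner_integral_unit_interval_exp[of k] this]
    have "has_bochner_integral lborel (\<lambda>t. unit_interval_exp k t + (\<Sum>n. F n t)) (of_real (r k))"
      using r0 by (simp split: if_splits)
    moreover have "f t *\<^sub>R cis (2 * pi * of_int k * t) = unit_interval_exp k t + (\<Sum>n. F n t)" for t
    proof -
      have F_eq: "F n t = (2 * s n * cos (2 * pi * Suc n * t)) *\<^sub>R unit_interval_exp k t" for n
      proof -
        have "cis (2 * pi * of_int (k + int (Suc n)) * t) + cis (2 * pi * of_int (k - int (Suc n)) * t) =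
            (2 * cos (2 * pi * Suc n * t)) *\<^sub>R cis (2 * pi * of_int k * t)"
          by (simp add: complex_eq_iff cos_add cos_diff sin_add sin_diff ring_distribs)
        then show ?thesis
          by (simp add: F_def unit_interval_exp_def flip: scaleR_add_right)
      qed
      have "(\<Sum>n. F n t) = (\<Sum>n. 2 * s n * cos (2 * pi * Suc n * t)) *\<^sub>R unit_interval_exp k t"
        unfolding F_eq
        by (rule suminf_scaleR_left[OF summable_rabs_cancel[OF summ_abs], symmetric])
      then show ?thesis
        by (simp add: f_def d_def unit_interval_exp_def scaleR_add_left distrib_left)
    qed
    ultimately show ?thesis
      by simp
  qed
  define \<nu> where "\<nu> = density lborel (\<lambda>t. ennreal (f t))"
  have int_f: "has_bochner_integral lborel f 1"
  proof -
    have "has_bochner_integral lborel (\<lambda>t. of_real (f t)) (1 :: complex)"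
      using coeff[of 0] by (simp add: r0 scaleR_conv_of_real)
    from has_bochner_integral_Re[OF this] show ?thesis
      by simp
  qed
  have "prob_space \<nu>"
  proof
    have "emeasure \<nu> (space \<nu>) = (\<integral>\<^sup>+ t. ennreal (f t) \<partial>lborel)"
      by (simp add: \<nu>_def emeasure_density)
    also have "\<dots> = ennreal 1"
      using int_f f_nonneg by (subst nn_integral_eq_integral) (auto simp: has_bochner_integral_iff)
    finally show "emeasure \<nu> (space \<nu>) = 1"
      by simp
  qed
  then have \<nu>: "\<nu> \<in> distributions"
    by (simp add: distributions_def \<nu>_def)
  have cont: "continuous_on UNIV circle_of_real"
    by (rule continuous_on_circle_of_real)
  show thesis
  proof (rule that)
    show "distr \<nu> borel circle_of_real \<in> distributions"
      by (rule distr_in_distributions[OF \<nu> cont])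
    fix k
    have "characteristic_function (distr \<nu> borel circle_of_real) (circle_character k) =
        (LINT t|\<nu>. cis (2 * pi * of_int k * t))"
      by (subst characteristic_function_distr[OF \<nu> circle_character_in_characters cont])
        (simp add: cis_power_int mult_ac)
    also have "\<dots> = (LINT t|lborel. f t *\<^sub>R cis (2 * pi * of_int k * t))"
      unfolding \<nu>_def by (rule integral_density) (simp_all add: f_nonneg borel_measurable_continuous_onI continuous_intros)
    also have "\<dots> = of_real (r k)"
      using coeff[of k] by (simp add: has_bochner_integral_iff)
    finally show "characteristic_function (distr \<nu> borel circle_of_real) (circle_character k) = of_real (r k)" .
  qed
qed

section \<open>The example on the torus\<close>

text \<open>The Fourier coefficients \<open>5 powr (- k\<^sup>2)\<close> of a wrapped normal distribution, doubled at odd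
  indices. Base 5 is the smallest integer for which twice the geometric series
  \<open>(\<Sum>n\<ge>1. 5 powr (- n))\<close> does not exceed \<open>1 / 2\<close>.\<close>

definition skewed_theta_coefficient :: "int \<Rightarrow> real"
  where "skewed_theta_coefficient k = (if even k then 1 else 2) * (1 / 5) powi k\<^sup>2"

lemma skewed_theta_coefficient_pos: "0 < skewed_theta_coefficient k"
  by (simp add: skewed_theta_coefficient_def zero_less_power_int)

text \<open>The functional equation for the characteristic functions reduces to this: the four indices on
  its two sides agree in parity and have the same sum of squares.\<close>

lemma skewed_theta_coefficient_mult4:
  assumes "even a = even a'" "even b = even b'" "even c = even c'" "even d = even d'"
    and "a\<^sup>2 + b\<^sup>2 + c\<^sup>2 + d\<^sup>2 = a'\<^sup>2 + b'\<^sup>2 + c'\<^sup>2 + d'\<^sup>2"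
  shows "skewed_theta_coefficient a * skewed_theta_coefficient b *
      (skewed_theta_coefficient c * skewed_theta_coefficient d) =
    skewed_theta_coefficient a' * skewed_theta_coefficient b' *
      (skewed_theta_coefficient c' * skewed_theta_coefficient d')"
proof -
  have "(1 / 5 :: real) powi a\<^sup>2 * (1 / 5) powi b\<^sup>2 * (1 / 5) powi c\<^sup>2 * (1 / 5) powi d\<^sup>2 =
      (1 / 5) powi a'\<^sup>2 * (1 / 5) powi b'\<^sup>2 * (1 / 5) powi c'\<^sup>2 * (1 / 5) powi d'\<^sup>2"
    using arg_cong[OF assms(5), of "\<lambda>n. (1 / 5 :: real) powi n"] by (simp add: power_int_add)
  then show ?thesis
    by (simp add: skewed_theta_coefficient_def assms(1-4))
qed

text \<open>The exponents \<open>k\<^sup>2\<close> are at least \<open>k\<close>, so a geometric series bounds the coefficients; its sum is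
  exactly the admissible \<open>1 / 2\<close>.\<close>

lemma skewed_theta_distribution:
  obtains \<rho> where "\<rho> \<in> distributions"
    "\<And>k. characteristic_function \<rho> (circle_character k) = of_real (skewed_theta_coefficient k)"
proof (rule circle_distribution_with_coefficients)
  have bound: "\<bar>skewed_theta_coefficient (int (Suc n))\<bar> \<le> 2 / 5 * (1 / 5) ^ n" for n
  proof -
    have "n + 1 \<le> (Suc n)\<^sup>2"
      by (simp add: power2_eq_square)
    then have "(1 / 5 :: real) ^ ((Suc n)\<^sup>2) \<le> (1 / 5) ^ (n + 1)"
      by (intro power_decreasing) auto
    moreover have "(int (Suc n))\<^sup>2 = int ((Suc n)\<^sup>2)"
      by simp
    then have "(1 / 5 :: real) powi (int (Suc n))\<^sup>2 = (1 / 5) ^ ((Suc n)\<^sup>2)"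
      by (simp only: power_int_of_nat)
    ultimately have "(1 / 5 :: real) powi (int (Suc n))\<^sup>2 \<le> 1 / 5 * (1 / 5) ^ n"
      by simp
    moreover have "\<bar>skewed_theta_coefficient (int (Suc n))\<bar> \<le> 2 * (1 / 5) powi (int (Suc n))\<^sup>2"
      by (simp add: skewed_theta_coefficient_def zero_le_power_int)
    ultimately show ?thesis
      by linarith
  qed
  have geom: "(\<lambda>n. 2 / 5 * (1 / 5 :: real) ^ n) sums (1 / 2)"
    using sums_mult[OF geometric_sums[of "1 / 5 :: real"], of "2 / 5"] by simp
  show summ: "summable (\<lambda>n. \<bar>skewed_theta_coefficient (int (Suc n))\<bar>)"
    by (rule summable_comparison_test'[OF sums_summable[OF geom], of 0]) (use bound in simp)
  show "(\<Sum>n. \<bar>skewed_theta_coefficient (int (Suc n))\<bar>) \<le> 1 / 2"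
    using suminf_le[OF bound summ sums_summable[OF geom]] sums_unique[OF geom] by simp
qed (auto simp: skewed_theta_coefficient_def)

text \<open>The matrix \<open>((-2, -1), (-1, -1))\<close>: it is symmetric, so that it also describes the action on
  characters, and its negative is positive definite.\<close>

definition heyde_automorphism :: "torus2 \<Rightarrow> torus2"
  where "heyde_automorphism x = (- fst x - fst x - snd x, - fst x - snd x)"

lemma heyde_automorphism_inverse:
  "heyde_automorphism (snd x - fst x, fst x - snd x - snd x) = x"
  "(\<lambda>z. (snd z - fst z, fst z - snd z - snd z)) (heyde_automorphism x) = x"
  by (simp_all add: heyde_automorphism_def prod_eq_iff)

lemma continuous_on_heyde_automorphism: "continuous_on UNIV heyde_automorphism"
  unfolding heyde_automorphism_def[abs_def] by (intro continuous_intros)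

lemma topological_automorphism_heyde_automorphism: "topological_automorphism heyde_automorphism"
proof -
  let ?\<beta> = "\<lambda>z :: torus2. (snd z - fst z, fst z - snd z - snd z)"
  have bij: "bij heyde_automorphism"
    by (rule o_bij[of ?\<beta>]) (simp_all add: fun_eq_iff heyde_automorphism_inverse)
  have "inv heyde_automorphism = ?\<beta>"
    by (rule inv_equality) (simp_all add: heyde_automorphism_inverse)
  moreover have "continuous_on UNIV ?\<beta>"
    by (intro continuous_intros)
  moreover have "heyde_automorphism (x + y) = heyde_automorphism x + heyde_automorphism y" for x y
    by (simp add: heyde_automorphism_def)
  ultimately show ?thesis
    using bij continuous_on_heyde_automorphism by (simp add: topological_automorphism_def)
qed

lemma torus_character_heyde_automorphism:
  "torus_character m n (heyde_automorphism x) = torus_character (- m - m - n) (- m - n) x"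
  by (simp only: torus_character_def heyde_automorphism_def fst_conv snd_conv diff_conv_add_uminus
      circle_character_plus circle_character_uminus circle_character_add_index
      circle_character_minus_index add_ac)

lemma torus_character_add_index:
  "torus_character (m + m') (n + n') x = torus_character m n x + torus_character m' n' x"
  by (simp add: torus_character_def circle_character_add_index add_ac)

lemma torus_character_uminus: "torus_character m n (- x) = torus_character (- m) (- n) x"
  by (simp add: torus_character_def circle_character_uminus circle_character_minus_index)

lemma torus_pair_separating:
  fixes a b :: "torus2 \<times> torus2"
  assumes "a \<noteq> b"
  shows "\<exists>y\<in>characters. y a \<noteq> y b"
proof -
  have "(\<lambda>x. fst (fst x)) \<in> (characters :: (torus2 \<times> torus2 \<Rightarrow> circle) set)"
    "(\<lambda>x. snd (fst x)) \<in> (characters :: (torus2 \<times> torus2 \<Rightarrow> circle) set)"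
    "(\<lambda>x. fst (snd x)) \<in> (characters :: (torus2 \<times> torus2 \<Rightarrow> circle) set)"
    "(\<lambda>x. snd (snd x)) \<in> (characters :: (torus2 \<times> torus2 \<Rightarrow> circle) set)"
    by (simp_all add: characters_def continuous_on_fst continuous_on_snd)
  moreover have "fst (fst a) \<noteq> fst (fst b) \<or> snd (fst a) \<noteq> snd (fst b) \<or>
      fst (snd a) \<noteq> fst (snd b) \<or> snd (snd a) \<noteq> snd (snd b)"
    using assms by (auto simp: prod_eq_iff)
  ultimately show ?thesis
    by (elim disjE) (rule bexI, assumption, assumption)+
qed

lemma compact_UNIV_torus_pair: "compact (UNIV :: (torus2 \<times> torus2) set)"
  unfolding UNIV_Times_UNIV[symmetric] by (intro compact_Times compact_UNIV_circle)

lemma generated_by_order_two: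
  fixes x :: "'a::ab_group_add"
  assumes "x \<in> group_closure {x. has_order x 2}"
  shows "x + x = 0"
  using assms
proof induction
  case (base s)
  then show ?case
    by (auto simp: has_order_def numeral_2_eq_2)
next
  case (diff s t)
  have "(s - t) + (s - t) = (s + s) - (t + t)"
    by (simp add: algebra_simps)
  then show ?case
    using diff by simp
qed

theorem theorem3p1:
  fixes G :: "torus2 set"
  assumes "G = group_closure {x. has_order x 2}"
  shows "\<exists>(\<alpha> :: torus2 \<Rightarrow> torus2) (M :: (torus2 \<times> torus2) measure) \<xi>\<^sub>1 \<xi>\<^sub>2 \<mu>\<^sub>1 \<mu>\<^sub>2.
    topological_automorphism \<alpha> \<and> {x. x + \<alpha> x = 0} = {0} \<and>
    prob_space M \<and> prob_space.indep_var M borel \<xi>\<^sub>1 borel \<xi>\<^sub>2 \<and>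
    \<mu>\<^sub>1 = distr M borel \<xi>\<^sub>1 \<and> \<mu>\<^sub>2 = distr M borel \<xi>\<^sub>2 \<and>
    nonvanishing_cf \<mu>\<^sub>1 \<and> nonvanishing_cf \<mu>\<^sub>2 \<and>
    conditionally_symmetric M (\<lambda>w. \<xi>\<^sub>1 w + \<alpha> (\<xi>\<^sub>2 w)) (\<lambda>w. \<xi>\<^sub>1 w + \<xi>\<^sub>2 w) \<and>
    \<mu>\<^sub>1 \<notin> gaussian_conv G \<and> \<mu>\<^sub>2 \<notin> gaussian_conv G"
proof -
  let ?r = skewed_theta_coefficient and ?\<alpha> = heyde_automorphism
  obtain \<rho> where \<rho>: "\<rho> \<in> distributions"
    and cf_\<rho>: "\<And>k. characteristic_function \<rho> (circle_character k) = of_real (?r k)"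
    by (rule skewed_theta_distribution) blast
  define \<mu>\<^sub>2 where "\<mu>\<^sub>2 = \<rho> \<Otimes>\<^sub>M \<rho>"
  define shear :: "torus2 \<Rightarrow> torus2" where "shear z = (fst z + snd z, snd z)" for z
  define \<mu>\<^sub>1 where "\<mu>\<^sub>1 = distr \<mu>\<^sub>2 borel shear"
  define M where "M = \<mu>\<^sub>1 \<Otimes>\<^sub>M \<mu>\<^sub>2"
  have shear: "continuous_on UNIV shear"
    unfolding shear_def[abs_def] by (intro continuous_intros)
  have \<mu>\<^sub>2: "\<mu>\<^sub>2 \<in> distributions"
    unfolding \<mu>\<^sub>2_def by (rule pair_in_distributions[OF \<rho> \<rho>])
  have \<mu>\<^sub>1: "\<mu>\<^sub>1 \<in> distributions"
    unfolding \<mu>\<^sub>1_def by (rule distr_in_distributions[OF \<mu>\<^sub>2 shear])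
  have M: "M \<in> distributions"
    unfolding M_def by (rule pair_in_distributions[OF \<mu>\<^sub>1 \<mu>\<^sub>2])
  have cf_product: "(LINT z|\<mu>\<^sub>2. circle_val (circle_character m (fst z) + circle_character n (snd z))) =
      of_real (?r m * ?r n)" for m n
    unfolding \<mu>\<^sub>2_def
    by (simp only: integral_pair_characters[OF \<rho> \<rho> circle_character_in_characters
          circle_character_in_characters] cf_\<rho> of_real_mult)
  have cf_\<mu>\<^sub>2: "characteristic_function \<mu>\<^sub>2 (torus_character m n) = of_real (?r m * ?r n)" for m n
    unfolding characteristic_function_def torus_character_def by (rule cf_product)
  have cf_\<mu>\<^sub>1: "characteristic_function \<mu>\<^sub>1 (torus_character m n) = of_real (?r m * ?r (m + n))" for m n
  proof -
    have "torus_character m n (shear z) =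
        circle_character m (fst z) + circle_character (m + n) (snd z)" for z
      by (simp add: torus_character_def shear_def circle_character_plus circle_character_add_index add_ac)
    then show ?thesis
      unfolding \<mu>\<^sub>1_def characteristic_function_distr[OF \<mu>\<^sub>2 torus_character_in_characters shear]
      by (simp only: cf_product)
  qed
  have symmetric: "conditionally_symmetric M (\<lambda>w. fst w + ?\<alpha> (snd w)) (\<lambda>w. fst w + snd w)"
    unfolding conditionally_symmetric_def
  proof (rule distribution_eqI_characteristic_function[OF _ _ compact_UNIV_torus_pair torus_pair_separating])
    let ?L = "\<lambda>w :: torus2 \<times> torus2. (fst w + snd w, fst w + ?\<alpha> (snd w))"
    let ?L' = "\<lambda>w :: torus2 \<times> torus2. (fst w + snd w, - (fst w + ?\<alpha> (snd w)))"
    have \<alpha>_snd: "continuous_on UNIV (\<lambda>w :: torus2 \<times> torus2. ?\<alpha> (snd w))"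
      by (rule continuous_on_compose2[OF continuous_on_heyde_automorphism]) (auto intro!: continuous_intros)
    have L: "continuous_on UNIV ?L" and L': "continuous_on UNIV ?L'"
      by (intro continuous_intros \<alpha>_snd)+
    show "distr M borel ?L \<in> distributions" "distr M borel ?L' \<in> distributions"
      by (rule distr_in_distributions[OF M L], rule distr_in_distributions[OF M L'])
    fix y :: "torus2 \<times> torus2 \<Rightarrow> circle"
    assume y: "y \<in> characters"
    have "(\<lambda>a. y (a, 0)) \<in> characters"
      by (rule character_compose[OF y]) (auto intro!: continuous_intros)
    from torus_characterE[OF this] obtain u\<^sub>1 u\<^sub>2 where u: "(\<lambda>a. y (a, 0)) = torus_character u\<^sub>1 u\<^sub>2"
      by blast
    have "(\<lambda>b. y (0, b)) \<in> characters"
      by (rule character_compose[OF y]) (auto intro!: continuous_intros)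
    from torus_characterE[OF this] obtain v\<^sub>1 v\<^sub>2 where v: "(\<lambda>b. y (0, b)) = torus_character v\<^sub>1 v\<^sub>2"
      by blast
    have y_eq: "y (a, b) = torus_character u\<^sub>1 u\<^sub>2 a + torus_character v\<^sub>1 v\<^sub>2 b" for a b
      using character_add[OF y, of "(a, 0)" "(0, b)"] fun_cong[OF u, of a] fun_cong[OF v, of b] by simp
    note tc = character_add[OF torus_character_in_characters] torus_character_heyde_automorphism
      torus_character_uminus torus_character_add_index
    \<comment> \<open>The character evaluated at the pair of linear forms splits into a character of \<open>\<xi>\<^sub>1\<close> and one of
        \<open>\<xi>\<^sub>2\<close>; negating the second linear form amounts to negating \<open>v\<close>.\<close>
    have yL: "y (?L w) =
        torus_character (u\<^sub>1 + v\<^sub>1) (u\<^sub>2 + v\<^sub>2) (fst w) +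
        torus_character (u\<^sub>1 + (- v\<^sub>1 - v\<^sub>1 - v\<^sub>2)) (u\<^sub>2 + (- v\<^sub>1 - v\<^sub>2)) (snd w)" for w
      unfolding y_eq tc by (simp only: add_ac)
    have yL': "y (?L' w) =
        torus_character (u\<^sub>1 + - v\<^sub>1) (u\<^sub>2 + - v\<^sub>2) (fst w) +
        torus_character (u\<^sub>1 + (- (- v\<^sub>1) - (- v\<^sub>1) - (- v\<^sub>2))) (u\<^sub>2 + (- (- v\<^sub>1) - (- v\<^sub>2))) (snd w)" for w
      unfolding y_eq tc by (simp only: add_ac)
    have cf_pair: "(LINT w|M. circle_val (torus_character m n (fst w) + torus_character k l (snd w))) =
        of_real (?r m * ?r (m + n) * (?r k * ?r l))" for m n k l
      unfolding M_def
      by (simp only: integral_pair_characters[OF \<mu>\<^sub>1 \<mu>\<^sub>2 torus_character_in_characters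
            torus_character_in_characters] cf_\<mu>\<^sub>1 cf_\<mu>\<^sub>2 of_real_mult)
    show "characteristic_function (distr M borel ?L) y = characteristic_function (distr M borel ?L') y"
      unfolding characteristic_function_distr[OF M y L] characteristic_function_distr[OF M y L'] yL yL' cf_pair
      by (intro arg_cong[where f = of_real] skewed_theta_coefficient_mult4)
        (presburger+, simp add: power2_eq_square algebra_simps)
  qed
  have r_nz: "?r k \<noteq> 0" for k
    using skewed_theta_coefficient_pos[of k] by simp
  have nonvanishing: "nonvanishing_cf \<mu>\<^sub>1" "nonvanishing_cf \<mu>\<^sub>2"
    unfolding nonvanishing_cf_def
    by (rule ballI, erule torus_characterE, simp add: cf_\<mu>\<^sub>1 cf_\<mu>\<^sub>2 r_nz)+
  have G_exponent: "x + x = 0" if "x \<in> G" for x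
    using generated_by_order_two that by (simp add: assms)
  \<comment> \<open>The direction \<open>(m, n)\<close> will be \<open>(1, -1)\<close> for \<open>\<mu>\<^sub>1\<close> and \<open>(1, 0)\<close> for \<open>\<mu>\<^sub>2\<close>: there one of the two
      factors of the characteristic function is \<open>r 0 = 1\<close>.\<close>
  have not_gaussian: "\<mu> \<notin> gaussian_conv G"
    if cf1: "characteristic_function \<mu> (torus_character m n) = of_real (?r 1)"
      and cf2: "characteristic_function \<mu> (torus_character (m + m) (n + n)) = of_real (?r 2)" for \<mu> m n
  proof
    assume "\<mu> \<in> gaussian_conv G"
    from gaussian_conv_norm_characteristic_function[OF this G_exponent torus_character_in_characters[of m n]]
    have "?r 1 ^ 4 \<le> ?r 2"
      by (simp only: torus_character_add_index[symmetric] cf1 cf2 norm_of_real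
          abs_of_pos[OF skewed_theta_coefficient_pos])
    moreover have "?r 1 = 2 / 5" "?r 2 = 1 / 625"
      by (simp_all add: skewed_theta_coefficient_def power_divide)
    ultimately show False
      by (simp add: power_divide)
  qed
  have r0: "?r 0 = 1"
    by (simp add: skewed_theta_coefficient_def)
  have ker: "{x. x + ?\<alpha> x = 0} = {0}"
    by (auto simp: heyde_automorphism_def prod_eq_iff)
  have "\<mu>\<^sub>1 \<notin> gaussian_conv G"
    by (rule not_gaussian[of _ 1 "- 1"]) (simp_all add: cf_\<mu>\<^sub>1 r0)
  moreover have "\<mu>\<^sub>2 \<notin> gaussian_conv G"
    by (rule not_gaussian[of _ 1 0]) (simp_all add: cf_\<mu>\<^sub>2 r0)
  moreover have "\<mu>\<^sub>1 = distr M borel fst" "\<mu>\<^sub>2 = distr M borel snd"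
    unfolding M_def using distr_pair_fst_borel[OF \<mu>\<^sub>1 \<mu>\<^sub>2] distr_pair_snd_borel[OF \<mu>\<^sub>1 \<mu>\<^sub>2] by simp_all
  moreover have "prob_space.indep_var M borel fst borel snd"
    unfolding M_def by (rule indep_var_pair_fst_snd[OF \<mu>\<^sub>1 \<mu>\<^sub>2])
  moreover note ker symmetric nonvanishing distributionsD(1)[OF M]
    topological_automorphism_heyde_automorphism
  ultimately show ?thesis
    by blast
qed

end
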